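(* If $f\in\mathcal{F}$, then the third Hankel determinant of the inverse function satisfies $$\left|H_{3,1}(f^{-1})\right|\le \frac{1}{16},$$ and the inequality is sharp: equality is attained for the function $f_0(z)=\dfrac{z}{\sqrt{1-z^2}}\in\mathcal{F}$.
   Context: Let $\mathbb{D}=\{z\in\mathbb{C}:|z|<1\}$ and let $\mathcal{A}$ be the family of all analytic functions $f$ on $\mathbb{D}$ of the form $f(z)=\sum_{t=1}^{\infty}a_t z^t$ with $a_1=1$. The class of Ozaki close-to-convex functions is $$\mathcal{F}=\left\{f\in\mathcal{A}\;:\;\operatorname{Re}\left(1+\frac{zf''(z)}{f'(z)}\right)>-\frac12 \text{ for all } z\in\mathbb{D}\right\}.$$ Functions in $\mathcal{F}$ are univalent in $\mathbb{D}$, so each $f\in\mathcal{F}$ has an inverse $f^{-1}$, analytic in some disc $|w|<r_0(f)$ with $r_0(f)\ge \tfrac14$, with expansion $f^{-1}(w)=w+\sum_{n=2}^{\infty}t_n w^n$. The third Hankel determinant of $f^{-1}$ is, with $t_1=1$, $$H_{3,1}(f^{-1})=\begin{vmatrix} t_1 & t_2 & t_3\\ t_2 & t_3 & t_4\\ t_3 & t_4 & t_5\end{vmatrix}=2t_2t_3t_4-t_3^3-t_4^2+t_3t_5-t_2^2t_5.$$ The square root in $f_0$ is the principal branch (value $1$ at $z=0$). *)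

theory Defs
  imports "HOL-Complex_Analysis.Complex_Analysis"
begin

abbreviation unit_disc :: "complex set" where
  "unit_disc \<equiv> ball 0 1"

text \<open>Functions are total in HOL; only the values on the unit disc matter.\<close>

definition class_A :: "(complex \<Rightarrow> complex) set" where
  "class_A = {f. f holomorphic_on unit_disc \<and>
     (\<exists>a :: nat \<Rightarrow> complex. a 1 = 1 \<and>
        (\<forall>z\<in>unit_disc. (\<lambda>t. a (Suc t) * z ^ Suc t) sums f z))}"

lemma class_A_iff:
  "f \<in> class_A \<longleftrightarrow> f holomorphic_on unit_disc \<and> f 0 = 0 \<and> deriv f 0 = 1"
proof
  assume "f \<in> class_A"
  then obtain a where hol: "f holomorphic_on unit_disc" and a1: "a (Suc 0) = (1::complex)"
    and a: "\<And>z. z \<in> unit_disc \<Longrightarrow> (\<lambda>t. a (Suc t) * z ^ Suc t) sums f z"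
    by (auto simp: class_A_def)
  have f0: "f 0 = 0"
    using sums_unique2[OF a[of 0]] by simp
  define b where "b = (\<lambda>n. if n = 0 then 0 else a n)"
  have b: "(\<lambda>n. b n * w ^ n) sums f w" if "w \<in> unit_disc" for w
    using a[OF that] sums_Suc_iff[of "\<lambda>n. b n * w ^ n" "f w"] by (simp add: b_def)
  have "eventually (\<lambda>w. w \<in> unit_disc) (nhds (0::complex))"
    by (intro eventually_nhds_in_open) auto
  then have "eventually (\<lambda>w. (\<lambda>n. fps_nth (Abs_fps b) n * w ^ n) sums f w) (nhds 0)"
    by eventually_elim (simp add: b)
  then have "f has_fps_expansion Abs_fps b"
    by (rule has_fps_expansionI)
  from fps_nth_fps_expansion[OF this, of 1] have "deriv f 0 = 1"
    using a1 by (simp add: b_def)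
  then show "f holomorphic_on unit_disc \<and> f 0 = 0 \<and> deriv f 0 = 1"
    using hol f0 by simp
next
  assume f: "f holomorphic_on unit_disc \<and> f 0 = 0 \<and> deriv f 0 = 1"
  have "(\<lambda>t. (deriv ^^ Suc t) f 0 / fact (Suc t) * z ^ Suc t) sums f z" if "z \<in> unit_disc" for z
    using holomorphic_power_series[of f 0 1 z] f that
      sums_Suc_iff[of "\<lambda>n. (deriv ^^ n) f 0 / fact n * z ^ n" "f z"] by simp
  then show "f \<in> class_A"
    using f unfolding class_A_def
    by (intro CollectI conjI exI[of _ "\<lambda>n. (deriv ^^ n) f 0 / fact n"]) auto
qed

text \<open>The condition \<^term>\<open>deriv f z \<noteq> 0\<close>, implicit in writing the quotient, has to be
  stated because division by zero yields zero in HOL.\<close>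

definition ozaki_close_to_convex :: "(complex \<Rightarrow> complex) set" where
  "ozaki_close_to_convex = {f \<in> class_A. \<forall>z\<in>unit_disc.
     deriv f z \<noteq> 0 \<and> Re (1 + z * deriv (deriv f) z / deriv f z) > - 1 / 2}"

text \<open>\<open>inverse_near_0 f g\<close>: on some disc around the origin, \<open>g\<close> is the analytic inverse of
  \<open>f\<close> with value \<open>0\<close> at \<open>0\<close>. Such a \<open>g\<close> exists for every \<open>f\<close> in \<open>class_A\<close>, its germ at \<open>0\<close> (hence
  its Taylor series) is unique, and if \<open>f\<close> is univalent on the unit disc it is the ordinary inverse
  function; see the lemmas below.\<close>

definition inverse_near_0 :: "(complex \<Rightarrow> complex) \<Rightarrow> (complex \<Rightarrow> complex) \<Rightarrow> bool" where
  "inverse_near_0 f g \<longleftrightarrow> g 0 = 0 \<and>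
     (\<exists>r>0. g holomorphic_on ball 0 r \<and>
        (\<forall>w\<in>ball 0 r. g w \<in> unit_disc \<and> f (g w) = w))"

lemma inverse_near_0_exists:
  assumes "f \<in> class_A"
  shows "\<exists>g. inverse_near_0 f g"
proof -
  have f: "f holomorphic_on unit_disc" "f 0 = 0" "deriv f 0 \<noteq> 0"
    using assms by (auto simp: class_A_iff)
  obtain s where s: "s > 0" "ball 0 s \<subseteq> unit_disc" "open (f ` ball 0 s)" "inj_on f (ball 0 s)"
    using has_complex_derivative_locally_invertible[of f unit_disc 0] f by auto
  have "f holomorphic_on ball 0 s"
    using f(1) s(2) by (rule holomorphic_on_subset)
  from holomorphic_has_inverse[OF this open_ball s(4)]
  obtain g where g: "g holomorphic_on f ` ball 0 s" "\<And>z. z \<in> ball 0 s \<Longrightarrow> g (f z) = z"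
    by metis
  have "0 \<in> f ` ball 0 s"
    using f s(1) by (metis centre_in_ball imageI)
  then obtain r where r: "r > 0" "ball 0 r \<subseteq> f ` ball 0 s"
    using s(3) openE by blast
  have "g 0 = 0"
    using g(2)[of 0] f(2) s(1) by simp
  moreover have "g w \<in> unit_disc \<and> f (g w) = w" if "w \<in> ball 0 r" for w
  proof -
    have "w \<in> f ` ball 0 s"
      using r(2) that by blast
    then obtain z where "z \<in> ball 0 s" "w = f z"
      by blast
    then show ?thesis
      using g(2) s(2) by auto
  qed
  ultimately show ?thesis
    unfolding inverse_near_0_def using r holomorphic_on_subset[OF g(1) r(2)] by blast
qed

lemma inverse_near_0_eq_the_inv_into:
  assumes "inj_on f unit_disc" and "inverse_near_0 f g"
  shows "eventually (\<lambda>w. g w = the_inv_into unit_disc f w) (nhds 0)"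
proof -
  obtain r where r: "r > 0" "\<And>w. w \<in> ball 0 r \<Longrightarrow> g w \<in> unit_disc \<and> f (g w) = w"
    using assms(2) by (auto simp: inverse_near_0_def)
  have "eventually (\<lambda>w. w \<in> ball 0 r) (nhds (0::complex))"
    using r(1) by (intro eventually_nhds_in_open) auto
  then show ?thesis
    by eventually_elim (metis r(2) assms(1) the_inv_into_f_f)
qed

lemma inverse_near_0_unique:
  assumes "f \<in> class_A" "inverse_near_0 f g" "inverse_near_0 f h"
  shows "eventually (\<lambda>w. g w = h w) (nhds 0)"
proof -
  have f: "f holomorphic_on unit_disc" "deriv f 0 \<noteq> 0"
    using assms(1) by (auto simp: class_A_iff)
  obtain s where s: "s > 0" "inj_on f (ball 0 s)"
    using has_complex_derivative_locally_injective[of f unit_disc 0] f by auto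
  have *: "eventually (\<lambda>w. k w \<in> ball 0 s \<and> f (k w) = w) (nhds 0)" if k: "inverse_near_0 f k" for k
  proof -
    obtain r where r: "r > 0" "k holomorphic_on ball 0 r" "\<And>w. w \<in> ball 0 r \<Longrightarrow> f (k w) = w"
      and k0: "k 0 = 0"
      using k by (auto simp: inverse_near_0_def)
    have ev: "eventually (\<lambda>w. w \<in> ball 0 r) (nhds (0::complex))"
      using r(1) by (intro eventually_nhds_in_open) auto
    have "isCont k 0"
      using r holomorphic_on_imp_continuous_on continuous_on_interior[of "ball 0 r" k 0] by simp
    then have "filterlim k (nhds 0) (nhds 0)"
      using k0 by (simp add: continuous_at tendsto_nhds_iff isCont_def)
    then have "eventually (\<lambda>w. k w \<in> ball 0 s) (nhds 0)"
      by (rule topological_tendstoD) (use s(1) in auto)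
    with ev show ?thesis
      by eventually_elim (use r(3) in auto)
  qed
  from *[OF assms(2)] *[OF assms(3)] show ?thesis
    by eventually_elim (metis s(2) inj_onD)
qed

definition taylor_coeff :: "(complex \<Rightarrow> complex) \<Rightarrow> nat \<Rightarrow> complex" where
  "taylor_coeff g n = fps_nth (fps_expansion g 0) n"

definition hankel_3_1 :: "(nat \<Rightarrow> complex) \<Rightarrow> complex" where
  "hankel_3_1 t = det (vector [vector [t 1, t 2, t 3],
                               vector [t 2, t 3, t 4],
                               vector [t 3, t 4, t 5]] :: complex^3^3)"

lemma hankel_3_1_expand:
  assumes "t 1 = 1"
  shows "hankel_3_1 t = 2 * t 2 * t 3 * t 4 - t 3 ^ 3 - t 4 ^ 2 + t 3 * t 5 - t 2 ^ 2 * t 5"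
  using assms by (simp add: hankel_3_1_def det_3 power2_eq_square power3_eq_cube algebra_simps)

end

theory Submission
  imports Defs
begin

text \<open>
  Let \<open>f\<close> be Ozaki close-to-convex and \<open>q = f'' / f'\<close>. The condition \<open>Re (z q) > - 3 / 2\<close> says
  exactly that \<open>\<phi> = q / (3 + z q)\<close> satisfies \<open>|z \<phi>| < 1\<close>, so by the Schwarz lemma \<open>\<phi>\<close> is
  bounded by 1 on the unit disc, and \<open>f'' (1 - z \<phi>) = 3 \<phi> f'\<close>. Comparing coefficients in this
  equation and inverting the series of \<open>f\<close>, one obtains the Hankel determinant of the inverse
  as a polynomial in the first four Taylor coefficients of \<open>\<phi>\<close> (\<open>hankel_inverse_eq\<close>).

  Three steps of the Schur algorithm express these coefficients by free parameters \<open>c, x, y, w\<close> in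
  the closed unit disc (\<open>schur_parameters\<close>). With \<open>m = 1 - |c|\<^sup>2\<close>, \<open>n = 1 - |x|\<^sup>2\<close>, \<open>k = 1 - |y|\<^sup>2\<close> the
  determinant becomes
  \<open>320 H = 5 c\<^sup>6 + m A + 4 m n (y B + y\<^sup>2 C + 3 k D w)\<close>
  with \<open>A, B, C, D\<close> depending on \<open>c\<close> and \<open>x\<close> only (\<open>hankel_poly_schur\<close>).
  Both \<open>|C|\<close> and \<open>3 |D|\<close> are at most \<open>M = m (5 + |x|\<^sup>2) + 3 |c|\<^sup>2\<close>, so the last bracket is at most
  \<open>|B| + M\<close>. The remaining terms are estimated by the triangle inequality; nothing
  essential is lost, since for small \<open>c\<close> the terms of \<open>5 c\<^sup>6 + m A\<close> have equal signs when \<open>c\<close> is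
  positive and \<open>x\<close> is negative. This leaves the inequality \<open>majorant_le\<close> in \<open>|c|\<close> and
  \<open>|x|\<close>, which reduces to a polynomial with positive coefficients in the Bernstein basis.

  For \<open>f\<^sub>0 = z / csqrt (1 - z\<^sup>2)\<close> one has \<open>\<phi> = z\<close>, and \<open>320 H = - 20\<close>.
\<close>

section \<open>The Hankel determinant in Schur parameters\<close>

text \<open>320 times the Hankel determinant of the inverse of \<open>f\<close>, as a polynomial in the Taylor
  coefficients \<open>w1, \<dots>, w4\<close> of the Schwarz function \<open>\<omega> = z \<phi>\<close> given by
  \<open>z f'' / f' = 3 \<omega> / (1 - \<omega>)\<close>. The factor 320 clears all denominators.\<close>

definition hankel_poly :: "complex \<Rightarrow> complex \<Rightarrow> complex \<Rightarrow> complex \<Rightarrow> complex" where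
  "hankel_poly w1 w2 w3 w4 =
     5 * w1^6 - 26 * w1^4 * w2 + 8 * w1^3 * w3 + 37 * w1^2 * w2^2 - 12 * w1^2 * w4
     + 4 * w1 * w2 * w3 - 20 * w2^3 + 24 * w2 * w4 - 20 * w3^2"

text \<open>The arguments are the coefficients in terms of the Schur parameters, with the conjugates
  \<open>c', x', y'\<close> replaced by independent variables: the identity is purely algebraic.\<close>

lemma hankel_poly_schur:
  fixes c c' x x' y y' w :: complex
  defines "m \<equiv> 1 - c * c'" and "n \<equiv> 1 - x * x'" and "k \<equiv> 1 - y * y'"
  shows "hankel_poly c (m * x) (m * (n * y - c' * x^2))
           (m * (c'^2 * x^3 - n * (2 * c' * x * y + x' * y^2) + n * k * w)) =
         5 * c^6
         + m * (- 26 * c^4 * x + (37 - 45 * (c * c')) * c^2 * x^2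
                - (20 - 36 * (c * c') + 28 * (c * c')^2) * x^3 + 4 * m * c'^2 * x^4)
         + 4 * m * n * (y * (x * (c - 2 * c' * x) + c * (c + 2 * c' * x) * (2 * c + c' * x))
                        + y^2 * (3 * c^2 * x' - m * (5 + x * x'))
                        + 3 * k * (2 * m * x - c^2) * w)"
  unfolding hankel_poly_def m_def n_def k_def by algebra

section \<open>The extremal problem\<close>

text \<open>In terms of the products \<open>t\<^sup>i (1 - t)\<^sup>2\<^sup>-\<^sup>i r\<^sup>j (1 - r)\<^sup>5\<^sup>-\<^sup>j\<close> all coefficients are positive.\<close>

lemma majorant_factor_nonneg:
  fixes t r :: real
  assumes "0 \<le> t" "t \<le> 1" "0 \<le> r" "r \<le> 1"
  shows "(1 - t)^2 * (22 - 14*r - 53*r^2 + 74*r^3 - 10*r^4 - 4*r^5)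
         + t * (1 - t) * (38 - 50*r - 38*r^2 + 80*r^3 - 8*r^4 - 8*r^5)
         + t^2 * (15 - 14*r^2 + 24*r^3 - 6*r^4 - 4*r^5) \<ge> 0"
proof -
  define q where "q = 1 - r"
  have "0 \<le> q"
    using assms by (simp add: q_def)
  have 0: "22 - 14*r - 53*r^2 + 74*r^3 - 10*r^4 - 4*r^5 =
     22*q^5 + 96*q^4*r + 111*q^3*r^2 + 51*q^2*r^3 + 33*q*r^4 + 15*r^5"
    unfolding q_def by algebra
  have 1: "38 - 50*r - 38*r^2 + 80*r^3 - 8*r^4 - 8*r^5 =
     38*q^5 + 140*q^4*r + 142*q^3*r^2 + 46*q^2*r^3 + 28*q*r^4 + 14*r^5"
    unfolding q_def by algebra
  have 2: "15 - 14*r^2 + 24*r^3 - 6*r^4 - 4*r^5 =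
     15*q^5 + 75*q^4*r + 136*q^3*r^2 + 132*q^2*r^3 + 75*q*r^4 + 15*r^5"
    unfolding q_def by algebra
  show ?thesis
    unfolding 0 1 2 using assms \<open>0 \<le> q\<close>
    by (intro add_nonneg_nonneg mult_nonneg_nonneg) auto
qed

text \<open>Here \<open>a\<close> and \<open>r\<close> are the moduli of the first two Schur parameters. Equality holds for
  \<open>a = 0\<close> with \<open>r = 0\<close> or \<open>r = 1\<close>. With \<open>t = a\<^sup>2\<close>, the amount by which the left-hand
  side stays below 20 is at least \<open>2 r\<^sup>2 (1 - r)\<^sup>2 (7 + 2 r)\<close> plus \<open>t\<close> times the polynomial of
  \<open>majorant_factor_nonneg\<close>.\<close>

lemma majorant_le:
  fixes a r :: real
  assumes "0 \<le> a" "a \<le> 1" "0 \<le> r" "r \<le> 1"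
  shows "5 * a^6 + (1 - a^2) * (26 * a^4 * r + \<bar>37 - 45 * a^2\<bar> * a^2 * r^2
            + (20 - 36 * a^2 + 28 * a^4) * r^3 + 4 * (1 - a^2) * a^2 * r^4)
         + 4 * (1 - a^2) * (1 - r^2) * ((1 + 2 * r) * (a * r + a^3 * (2 + r))
            + ((1 - a^2) * (5 + r^2) + 3 * a^2)) \<le> 20"
proof -
  define t where "t = a^2"
  have t: "0 \<le> t" "t \<le> 1"
    using assms by (auto simp: t_def power_le_one)
  have pow: "a^4 = t^2" "a^6 = t^3"
    by (simp_all add: t_def flip: power_mult)
  have n: "0 \<le> 1 - r^2"
    using assms by (simp add: power_le_one)
  \<comment> \<open>The right-hand side is the chord on \<open>[0, 1]\<close> of the convex left-hand side.\<close>
  have abs_le: "\<bar>37 - 45 * t\<bar> \<le> 37 - 29 * t"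
    using t by linarith
  \<comment> \<open>Odd powers of \<open>a\<close> are removed by the inequality of arithmetic and geometric means.\<close>
  have ar: "a * r \<le> (t + r^2) / 2"
    using sum_squares_bound[of a r] by (simp add: t_def)
  have "a^3 = a * t"
    by (simp add: t_def power3_eq_cube power2_eq_square)
  also have "a * t \<le> (t + t^2) / 2"
  proof -
    have "2 * a * 1 \<le> a^2 + 1^2"
      by (rule sum_squares_bound)
    then have "t * (2 * a) \<le> t * (t + 1)"
      using t by (intro mult_left_mono) (auto simp: t_def)
    then show ?thesis
      by (simp add: power2_eq_square algebra_simps)
  qed
  finally have a3: "a^3 \<le> (t + t^2) / 2" .
  have "5 * a^6 + (1 - a^2) * (26 * a^4 * r + \<bar>37 - 45 * a^2\<bar> * a^2 * r^2
            + (20 - 36 * a^2 + 28 * a^4) * r^3 + 4 * (1 - a^2) * a^2 * r^4)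
         + 4 * (1 - a^2) * (1 - r^2) * ((1 + 2 * r) * (a * r + a^3 * (2 + r))
            + ((1 - a^2) * (5 + r^2) + 3 * a^2))
      \<le> 5 * t^3 + (1 - t) * (26 * t^2 * r + (37 - 29 * t) * t * r^2
            + (20 - 36 * t + 28 * t^2) * r^3 + 4 * (1 - t) * t * r^4)
         + 4 * (1 - t) * (1 - r^2) * ((1 + 2 * r) * ((t + r^2) / 2 + (t + t^2) / 2 * (2 + r))
            + ((1 - t) * (5 + r^2) + 3 * t))"
    unfolding t_def[symmetric] pow
    using assms t n abs_le ar a3
    by (intro add_mono mult_left_mono mult_right_mono order_refl mult_nonneg_nonneg) auto
  also have "\<dots> = 20 - (2 * (r * (1 - r))^2 * (7 + 2 * r)
       + t * ((1 - t)^2 * (22 - 14*r - 53*r^2 + 74*r^3 - 10*r^4 - 4*r^5)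
         + t * (1 - t) * (38 - 50*r - 38*r^2 + 80*r^3 - 8*r^4 - 8*r^5)
         + t^2 * (15 - 14*r^2 + 24*r^3 - 6*r^4 - 4*r^5)))"
    by (simp add: field_simps) algebra
  also have "\<dots> \<le> 20"
  proof -
    have "0 \<le> 2 * (r * (1 - r))^2 * (7 + 2 * r)"
      using assms by simp
    moreover have "0 \<le> t * ((1 - t)^2 * (22 - 14*r - 53*r^2 + 74*r^3 - 10*r^4 - 4*r^5)
         + t * (1 - t) * (38 - 50*r - 38*r^2 + 80*r^3 - 8*r^4 - 8*r^5)
         + t^2 * (15 - 14*r^2 + 24*r^3 - 6*r^4 - 4*r^5))"
      using t assms by (intro mult_nonneg_nonneg majorant_factor_nonneg)
    ultimately show ?thesis
      by linarith
  qed
  finally show ?thesis .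
qed

lemma norm_hankel_poly_schur_le:
  assumes "norm c \<le> 1" "norm x \<le> 1" "norm y \<le> 1" "norm w \<le> 1"
  defines "m \<equiv> 1 - c * cnj c" and "n \<equiv> 1 - x * cnj x" and "k \<equiv> 1 - y * cnj y"
  shows "norm (hankel_poly c (m * x) (m * (n * y - cnj c * x^2))
           (m * ((cnj c)^2 * x^3 - n * (2 * cnj c * x * y + cnj x * y^2) + n * k * w))) \<le> 20"
proof -
  define a r s where "a = norm c" and "r = norm x" and "s = norm y"
  define t where "t = a^2"
  have a: "0 \<le> a" "a \<le> 1" and r: "0 \<le> r" "r \<le> 1" and s: "0 \<le> s" "s \<le> 1"
    using assms by (auto simp: a_def r_def s_def)
  have cc: "c * cnj c = of_real t" and xx: "x * cnj x = of_real (r^2)"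
    and yy: "y * cnj y = of_real (s^2)"
    by (simp_all only: t_def a_def r_def s_def complex_norm_square)
  have m: "m = of_real (1 - t)" and n: "n = of_real (1 - r^2)" and k: "k = of_real (1 - s^2)"
    by (simp_all add: m_def n_def k_def cc xx yy)
  have t: "0 \<le> t" "t \<le> 1"
    using a by (auto simp: t_def power_le_one)
  have sq: "r^2 \<le> 1" "s^2 \<le> 1"
    using r s by (auto simp: power_le_one)
  have norm_m: "norm m = 1 - t" and norm_n: "norm n = 1 - r^2" and norm_k: "norm k = 1 - s^2"
    unfolding m n k norm_of_real using t sq by auto
  define A where "A = - 26 * c^4 * x + (37 - 45 * (c * cnj c)) * c^2 * x^2
                - (20 - 36 * (c * cnj c) + 28 * (c * cnj c)^2) * x^3 + 4 * m * (cnj c)^2 * x^4"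
  define B where "B = x * (c - 2 * cnj c * x) + c * (c + 2 * cnj c * x) * (2 * c + cnj c * x)"
  define C where "C = 3 * c^2 * cnj x - m * (5 + x * cnj x)"
  define D where "D = 2 * m * x - c^2"
  define M where "M = (1 - t) * (5 + r^2) + 3 * t"
  have "norm A \<le> norm (- 26 * c^4 * x) + norm ((37 - 45 * (c * cnj c)) * c^2 * x^2)
        + norm ((20 - 36 * (c * cnj c) + 28 * (c * cnj c)^2) * x^3) + norm (4 * m * (cnj c)^2 * x^4)"
    unfolding A_def by norm
  also have "norm (- 26 * c^4 * x) = 26 * a^4 * r"
    by (simp add: norm_mult norm_power a_def r_def)
  also have "norm ((37 - 45 * (c * cnj c)) * c^2 * x^2) = \<bar>37 - 45 * t\<bar> * a^2 * r^2"
  proof -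
    have "37 - 45 * (c * cnj c) = of_real (37 - 45 * t)"
      by (simp add: cc)
    then show ?thesis
      by (simp only: norm_mult norm_power norm_of_real a_def r_def)
  qed
  also have "norm ((20 - 36 * (c * cnj c) + 28 * (c * cnj c)^2) * x^3) = (20 - 36 * t + 28 * t^2) * r^3"
  proof -
    have "20 - 36 * (c * cnj c) + 28 * (c * cnj c)^2 = of_real (20 - 36 * t + 28 * t^2)"
      by (simp add: cc)
    moreover have "20 - 36 * t + 28 * t^2 = 28 * (t - 9 / 14)^2 + 59 / 7"
      by (simp add: power2_eq_square field_simps)
    ultimately show ?thesis
      by (simp only: norm_mult norm_power norm_of_real r_def) simp
  qed
  also have "norm (4 * m * (cnj c)^2 * x^4) = 4 * (1 - t) * a^2 * r^4"
    by (simp add: norm_mult norm_power norm_m a_def r_def)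
  finally have A: "norm A \<le> 26 * a^4 * r + \<bar>37 - 45 * t\<bar> * a^2 * r^2
      + (20 - 36 * t + 28 * t^2) * r^3 + 4 * (1 - t) * a^2 * r^4" .
  have B: "norm B \<le> (1 + 2 * r) * (a * r + a^3 * (2 + r))"
  proof -
    have 1: "norm (c - 2 * cnj c * x) \<le> a * (1 + 2 * r)"
      using norm_triangle_ineq4[of c "2 * cnj c * x"]
      by (simp add: norm_mult a_def r_def algebra_simps)
    have 2: "norm (c + 2 * cnj c * x) \<le> a * (1 + 2 * r)"
      using norm_triangle_ineq[of c "2 * cnj c * x"]
      by (simp add: norm_mult a_def r_def algebra_simps)
    have 3: "norm (2 * c + cnj c * x) \<le> a * (2 + r)"
      using norm_triangle_ineq[of "2 * c" "cnj c * x"]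
      by (simp add: norm_mult a_def r_def algebra_simps)
    have "norm B \<le> r * norm (c - 2 * cnj c * x)
                   + a * norm (c + 2 * cnj c * x) * norm (2 * c + cnj c * x)"
      unfolding B_def a_def r_def by (rule norm_triangle_le) (simp add: norm_mult)
    also have "\<dots> \<le> r * (a * (1 + 2 * r)) + a * (a * (1 + 2 * r)) * (a * (2 + r))"
      using 1 2 3 a r by (intro add_mono mult_mono mult_nonneg_nonneg) auto
    also have "\<dots> = (1 + 2 * r) * (a * r + a^3 * (2 + r))"
      by algebra
    finally show ?thesis .
  qed
  have C: "norm C \<le> M"
  proof -
    have "5 + x * cnj x = of_real (5 + r^2)"
      by (simp add: xx)
    then have "norm (5 + x * cnj x) = 5 + r^2"
      by (simp only: norm_of_real) simp
    then have "norm C \<le> 3 * t * r + (1 - t) * (5 + r^2)"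
      unfolding C_def
      by (intro order_trans[OF norm_triangle_ineq4])
         (simp add: norm_mult norm_power norm_m a_def r_def t_def)
    moreover have "t * r \<le> t"
      using t r by (simp add: mult_left_le)
    ultimately show ?thesis
      by (simp add: M_def)
  qed
  have D: "norm (3 * D) \<le> M"
  proof -
    have "norm D \<le> 2 * (1 - t) * r + t"
      unfolding D_def
      by (intro order_trans[OF norm_triangle_ineq4])
         (simp add: norm_mult norm_power norm_m a_def r_def t_def)
    moreover have "(1 - t) * (6 * r) \<le> (1 - t) * (5 + r^2)"
    proof (rule mult_left_mono)
      have "0 \<le> (1 - r) * (5 - r)"
        using r by simp
      then show "6 * r \<le> 5 + r^2"
        by (simp add: power2_eq_square algebra_simps)
    qed (use t in simp)
    ultimately show ?thesis
      by (simp add: M_def norm_mult algebra_simps)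
  qed
  \<comment> \<open>As \<open>norm k = 1 - s\<^sup>2\<close>, the last two terms form at most a convex combination of \<open>norm C\<close> and
    \<open>norm (3 * D)\<close>.\<close>
  have E: "norm (y * B + y^2 * C + 3 * k * D * w) \<le> norm B + M"
  proof -
    have "norm (y * B + y^2 * C + 3 * k * D * w)
        \<le> norm (y * B) + norm (y^2 * C) + norm (3 * k * D * w)"
      by norm
    also have "\<dots> = s * norm B + s^2 * norm C + (1 - s^2) * norm (3 * D) * norm w"
      by (simp add: norm_mult norm_power norm_k s_def)
    also have "\<dots> \<le> 1 * norm B + s^2 * M + (1 - s^2) * M * 1"
      using s sq C D assms(4) order_trans[OF norm_ge_zero C]
      by (intro add_mono mult_mono mult_nonneg_nonneg) auto
    finally show ?thesis
      by (simp add: algebra_simps)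
  qed
  have "norm (hankel_poly c (m * x) (m * (n * y - cnj c * x^2))
           (m * ((cnj c)^2 * x^3 - n * (2 * cnj c * x * y + cnj x * y^2) + n * k * w)))
      = norm (5 * c^6 + m * A + 4 * m * n * (y * B + y^2 * C + 3 * k * D * w))"
    unfolding m_def n_def k_def hankel_poly_schur A_def B_def C_def D_def ..
  also have "\<dots> \<le> norm (5 * c^6) + norm (m * A)
                 + norm (4 * m * n * (y * B + y^2 * C + 3 * k * D * w))"
    by norm
  also have "\<dots> = 5 * a^6 + (1 - t) * norm A
                 + 4 * (1 - t) * (1 - r^2) * norm (y * B + y^2 * C + 3 * k * D * w)"
    by (simp add: norm_mult norm_power norm_m norm_n a_def)
  also have "\<dots> \<le> 5 * a^6 + (1 - t) * (26 * a^4 * r + \<bar>37 - 45 * t\<bar> * a^2 * r^2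
      + (20 - 36 * t + 28 * t^2) * r^3 + 4 * (1 - t) * a^2 * r^4)
      + 4 * (1 - t) * (1 - r^2) * ((1 + 2 * r) * (a * r + a^3 * (2 + r)) + M)"
    using t sq A B E by (intro add_mono mult_left_mono mult_nonneg_nonneg) auto
  also have "\<dots> \<le> 20"
    using majorant_le[OF a r] by (simp add: t_def M_def flip: power_mult)
  finally show ?thesis .
qed

section \<open>The Schur algorithm\<close>

lemma norm_moebius_lt_1:
  assumes "norm c < 1" "norm w < 1"
  shows "norm ((w - c) / (1 - cnj c * w)) < 1"
  using Moebius_function_norm_lt_1[of c w 0] assms
  by (simp add: Moebius_function_def)

text \<open>The Schwarz lemma as a statement on the quotient by \<open>z\<close>, including the point 0.\<close>

lemma schwarz_quotient:
  assumes "h holomorphic_on ball 0 1" "h 0 = 0" "\<And>z. norm z < 1 \<Longrightarrow> norm (h z) < 1"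
  obtains \<psi> where "\<psi> holomorphic_on ball 0 1" "\<And>z. norm z < 1 \<Longrightarrow> h z = z * \<psi> z"
    "\<And>z. norm z < 1 \<Longrightarrow> norm (\<psi> z) \<le> 1"
proof -
  obtain \<psi> where \<psi>: "\<psi> holomorphic_on ball 0 1" "\<And>z. norm z < 1 \<Longrightarrow> h z = z * \<psi> z"
    "deriv h 0 = \<psi> 0"
    using Schwarz3[OF assms(1,2)] by metis
  have "norm (\<psi> z) \<le> 1" if z: "norm z < 1" for z
  proof (cases "z = 0")
    case True
    then show ?thesis
      using Schwarz_Lemma(2)[OF assms, of 0] \<psi>(3) by simp
  next
    case False
    then show ?thesis
      using Schwarz_Lemma(1)[OF assms z] \<psi>(2)[OF z] by (simp add: norm_mult)
  qed
  with \<psi> that show ?thesis by blast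
qed

text \<open>Holomorphic functions on the unit disc that are bounded by 1. The bound is not strict, so
  that unimodular constants belong to the class.\<close>

definition schur_class :: "(complex \<Rightarrow> complex) set" where
  "schur_class = {\<phi>. \<phi> holomorphic_on ball 0 1 \<and> (\<forall>z\<in>ball 0 1. norm (\<phi> z) \<le> 1)}"

text \<open>One step of the Schur algorithm: \<open>z \<psi> = (\<phi> - c) / (1 - cnj c \<phi>)\<close> with \<open>c = \<phi> 0\<close>, cleared of
  denominators. In this form it covers the degenerate case \<open>|c| = 1\<close> as well, where \<open>\<phi>\<close> is
  constant and \<open>\<psi> = 0\<close> serves.\<close>

lemma schur_step:
  assumes "\<phi> \<in> schur_class"
  obtains \<psi> where "\<psi> \<in> schur_class"
    "\<And>z. z \<in> ball 0 1 \<Longrightarrow> \<phi> z * (1 + cnj (\<phi> 0) * z * \<psi> z) = \<phi> 0 + z * \<psi> z"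
proof -
  have hol: "\<phi> holomorphic_on ball 0 1" and le: "\<And>z. norm z < 1 \<Longrightarrow> norm (\<phi> z) \<le> 1"
    using assms by (auto simp: schur_class_def)
  define c where "c = \<phi> 0"
  have const: "\<phi> z = c" if z1: "norm z1 < 1" "norm (\<phi> z1) = 1" and z: "norm z < 1" for z1 z
  proof -
    have "\<phi> constant_on ball 0 1"
      by (rule maximum_modulus_principle[OF hol, where U = "ball 0 1" and \<xi> = z1])
         (use z1 le in auto)
    then show ?thesis
      using z by (auto simp: constant_on_def c_def)
  qed
  show ?thesis
  proof (cases "norm c = 1")
    case True
    show ?thesis
    proof (rule that[of "\<lambda>_. 0"])
      fix z :: complex
      assume "z \<in> ball 0 1"
      then have "\<phi> z = \<phi> 0"
        using const[of 0 z] True unfolding c_def by simp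
      then show "\<phi> z * (1 + cnj (\<phi> 0) * z * 0) = \<phi> 0 + z * 0"
        by simp
    qed (simp add: schur_class_def)
  next
    case False
    then have c: "norm c < 1"
      using le[of 0] by (simp add: c_def)
    have lt: "norm (\<phi> z) < 1" if z: "norm z < 1" for z
    proof -
      have "norm (\<phi> z) \<noteq> 1"
        using const[OF z _ z] False by auto
      then show ?thesis
        using le[OF z] by simp
    qed
    define h where "h = (\<lambda>z. (\<phi> z - c) / (1 - cnj c * \<phi> z))"
    have nz: "1 - cnj c * \<phi> z \<noteq> 0" if z: "norm z < 1" for z
    proof
      assume "1 - cnj c * \<phi> z = 0"
      then have "norm (cnj c * \<phi> z) = 1"
        by (metis norm_one right_minus_eq)
      moreover have "norm (cnj c * \<phi> z) < 1 * 1"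
        unfolding norm_mult using c lt[OF z] by (intro mult_strict_mono') auto
      ultimately show False by simp
    qed
    have h1: "h holomorphic_on ball 0 1"
      unfolding h_def using nz by (intro holomorphic_intros hol) auto
    have h2: "h 0 = 0"
      by (simp add: h_def c_def)
    have h3: "norm (h z) < 1" if "norm z < 1" for z
      unfolding h_def using norm_moebius_lt_1[OF c lt[OF that]] .
    obtain \<psi> where \<psi>: "\<psi> holomorphic_on ball 0 1"
      "\<And>z. norm z < 1 \<Longrightarrow> h z = z * \<psi> z" "\<And>z. norm z < 1 \<Longrightarrow> norm (\<psi> z) \<le> 1"
      using schwarz_quotient[OF h1 h2 h3] by metis
    have "\<phi> z * (1 + cnj c * (z * \<psi> z)) = c + z * \<psi> z" if z: "norm z < 1" for z
    proof -
      have "h z * (1 - cnj c * \<phi> z) = \<phi> z - c"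
        using nz[OF z] by (simp add: h_def)
      then show ?thesis
        unfolding \<psi>(2)[OF z, symmetric] by (simp add: algebra_simps)
    qed
    with \<psi>(1,3) show ?thesis
      unfolding c_def by (intro that[of \<psi>]) (simp_all add: schur_class_def mult.assoc)
  qed
qed

lemma schur_class_has_fps_expansion:
  assumes "\<phi> \<in> schur_class"
  shows "\<phi> has_fps_expansion fps_expansion \<phi> 0"
  using assms by (intro has_fps_expansion_fps_expansion[of "ball 0 1"]) (auto simp: schur_class_def)

lemma has_fps_expansion_eqI:
  fixes f g :: "complex \<Rightarrow> complex"
  assumes "f has_fps_expansion F" "g has_fps_expansion G"
    and "open A" "0 \<in> A" "\<And>z. z \<in> A \<Longrightarrow> f z = g z"
  shows "F = G"
proof -
  have "eventually (\<lambda>z. f z = g z) (nhds 0)"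
    using assms(3-5) eventually_nhds by blast
  then have "f has_fps_expansion G"
    using assms(2) has_fps_expansion_cong by blast
  with assms(1) show ?thesis
    by (rule fps_expansion_unique_complex)
qed

text \<open>A Schur step on Taylor coefficients: a recursion for those of \<open>\<phi>\<close> in terms of those of
  \<open>\<psi>\<close>.\<close>

lemma schur_step_coeffs:
  assumes "\<phi> \<in> schur_class"
  obtains \<psi> where "\<psi> \<in> schur_class"
    "\<And>n. taylor_coeff \<phi> (Suc n) = taylor_coeff \<psi> n
       - cnj (\<phi> 0) * (\<Sum>i\<le>n. taylor_coeff \<psi> i * taylor_coeff \<phi> (n - i))"
proof -
  obtain \<psi> where \<psi>: "\<psi> \<in> schur_class"
    "\<And>z. z \<in> ball 0 1 \<Longrightarrow> \<phi> z * (1 + cnj (\<phi> 0) * z * \<psi> z) = \<phi> 0 + z * \<psi> z"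
    using schur_step[OF assms] by blast
  define F G where "F = fps_expansion \<phi> 0" and "G = fps_expansion \<psi> 0"
  have F: "\<phi> has_fps_expansion F" and G: "\<psi> has_fps_expansion G"
    unfolding F_def G_def using assms \<psi>(1) by (auto intro: schur_class_has_fps_expansion)
  have "F * (1 + fps_const (cnj (\<phi> 0)) * fps_X * G) = fps_const (\<phi> 0) + fps_X * G"
  proof (rule has_fps_expansion_eqI)
    show "(\<lambda>z. \<phi> z * (1 + cnj (\<phi> 0) * z * \<psi> z)) has_fps_expansion
          F * (1 + fps_const (cnj (\<phi> 0)) * fps_X * G)"
      by (intro fps_expansion_intros F G)
    show "(\<lambda>z. \<phi> 0 + z * \<psi> z) has_fps_expansion fps_const (\<phi> 0) + fps_X * G"
      by (intro fps_expansion_intros G)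
  qed (use \<psi>(2) in \<open>auto intro: open_ball[of 0 1]\<close>)
  then have eq: "F = fps_const (\<phi> 0) + fps_X * (G - fps_const (cnj (\<phi> 0)) * (G * F))"
    by (simp add: algebra_simps)
  have "fps_nth F (Suc n) = fps_nth G n
          - cnj (\<phi> 0) * (\<Sum>i\<le>n. fps_nth G i * fps_nth F (n - i))" for n
  proof -
    have "fps_nth F (Suc n) = fps_nth G n - cnj (\<phi> 0) * fps_nth (G * F) n"
      by (subst eq) simp
    then show ?thesis
      by (simp add: fps_mult_nth atMost_atLeast0)
  qed
  with \<psi>(1) show ?thesis
    by (intro that[of \<psi>]) (auto simp: F_def G_def taylor_coeff_def)
qed

lemma taylor_coeff_0: "taylor_coeff f 0 = f 0"
  by (simp add: taylor_coeff_def fps_expansion_def)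

text \<open>The parameters are the values at 0 of \<open>\<phi>\<close> and of its first three Schur iterates.\<close>

lemma schur_parameters:
  assumes "\<phi> \<in> schur_class"
  obtains c x y w where "norm c \<le> 1" "norm x \<le> 1" "norm y \<le> 1" "norm w \<le> 1"
    "taylor_coeff \<phi> 0 = c"
    "taylor_coeff \<phi> 1 = (1 - c * cnj c) * x"
    "taylor_coeff \<phi> 2 = (1 - c * cnj c) * ((1 - x * cnj x) * y - cnj c * x^2)"
    "taylor_coeff \<phi> 3 = (1 - c * cnj c) * ((cnj c)^2 * x^3
       - (1 - x * cnj x) * (2 * cnj c * x * y + cnj x * y^2)
       + (1 - x * cnj x) * (1 - y * cnj y) * w)"
proof -
  have bound: "norm (\<theta> 0) \<le> 1" if "\<theta> \<in> schur_class" for \<theta>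
    using that by (simp add: schur_class_def)
  obtain \<psi> where \<psi>: "\<psi> \<in> schur_class"
    "\<And>n. taylor_coeff \<phi> (Suc n) = taylor_coeff \<psi> n
       - cnj (\<phi> 0) * (\<Sum>i\<le>n. taylor_coeff \<psi> i * taylor_coeff \<phi> (n - i))"
    using schur_step_coeffs[OF assms] by blast
  obtain \<theta> where \<theta>: "\<theta> \<in> schur_class"
    "\<And>n. taylor_coeff \<psi> (Suc n) = taylor_coeff \<theta> n
       - cnj (\<psi> 0) * (\<Sum>i\<le>n. taylor_coeff \<theta> i * taylor_coeff \<psi> (n - i))"
    using schur_step_coeffs[OF \<psi>(1)] by blast
  obtain \<omega> where \<omega>: "\<omega> \<in> schur_class"
    "\<And>n. taylor_coeff \<theta> (Suc n) = taylor_coeff \<omega> n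
       - cnj (\<theta> 0) * (\<Sum>i\<le>n. taylor_coeff \<omega> i * taylor_coeff \<theta> (n - i))"
    using schur_step_coeffs[OF \<theta>(1)] by blast
  define c x y w where "c = \<phi> 0" and "x = \<psi> 0" and "y = \<theta> 0" and "w = \<omega> 0"
  note defs = taylor_coeff_0 c_def[symmetric] x_def[symmetric] y_def[symmetric] w_def[symmetric]
  have y1: "taylor_coeff \<theta> 1 = (1 - y * cnj y) * w"
    using \<omega>(2)[of 0] unfolding One_nat_def by (simp add: defs algebra_simps)
  have x1: "taylor_coeff \<psi> 1 = (1 - x * cnj x) * y"
    using \<theta>(2)[of 0] unfolding One_nat_def by (simp add: defs algebra_simps)
  have x2: "taylor_coeff \<psi> 2 = (1 - x * cnj x) * ((1 - y * cnj y) * w - cnj x * y^2)"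
  proof -
    have "taylor_coeff \<psi> 2 = taylor_coeff \<theta> 1
        - cnj x * (y * taylor_coeff \<psi> 1 + taylor_coeff \<theta> 1 * x)"
      using \<theta>(2)[of 1] by (simp add: defs numeral_2_eq_2)
    also have "\<dots> = (1 - x * cnj x) * ((1 - y * cnj y) * w - cnj x * y^2)"
      unfolding x1 y1 by algebra
    finally show ?thesis .
  qed
  have c1: "taylor_coeff \<phi> 1 = (1 - c * cnj c) * x"
    using \<psi>(2)[of 0] unfolding One_nat_def by (simp add: defs algebra_simps)
  have c2: "taylor_coeff \<phi> 2 = (1 - c * cnj c) * ((1 - x * cnj x) * y - cnj c * x^2)"
  proof -
    have "taylor_coeff \<phi> 2 = taylor_coeff \<psi> 1
        - cnj c * (x * taylor_coeff \<phi> 1 + taylor_coeff \<psi> 1 * c)"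
      using \<psi>(2)[of 1] by (simp add: defs numeral_2_eq_2)
    also have "\<dots> = (1 - c * cnj c) * ((1 - x * cnj x) * y - cnj c * x^2)"
      unfolding x1 c1 by algebra
    finally show ?thesis .
  qed
  have c3: "taylor_coeff \<phi> 3 = (1 - c * cnj c) * ((cnj c)^2 * x^3
       - (1 - x * cnj x) * (2 * cnj c * x * y + cnj x * y^2)
       + (1 - x * cnj x) * (1 - y * cnj y) * w)"
  proof -
    have "taylor_coeff \<phi> 3 = taylor_coeff \<psi> 2
        - cnj c * (x * taylor_coeff \<phi> 2 + taylor_coeff \<psi> 1 * taylor_coeff \<phi> 1
                   + taylor_coeff \<psi> 2 * c)"
      using \<psi>(2)[of 2] by (simp add: defs eval_nat_numeral)
    also have "\<dots> = (1 - c * cnj c) * ((cnj c)^2 * x^3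
       - (1 - x * cnj x) * (2 * cnj c * x * y + cnj x * y^2)
       + (1 - x * cnj x) * (1 - y * cnj y) * w)"
      unfolding x1 x2 c1 c2 by algebra
    finally show ?thesis .
  qed
  have "norm c \<le> 1" "norm x \<le> 1" "norm y \<le> 1" "norm w \<le> 1"
    unfolding c_def x_def y_def w_def using bound assms \<psi>(1) \<theta>(1) \<omega>(1) by blast+
  moreover have "taylor_coeff \<phi> 0 = c"
    by (simp add: defs)
  ultimately show ?thesis
    using that c1 c2 c3 by blast
qed

section \<open>Coefficients of the function and of its inverse\<close>

text \<open>The equation \<open>F'' (1 - X P) = 3 P F'\<close> and \<open>F' 0 = 1\<close> determine the coefficients of \<open>F\<close> of
  positive index recursively.\<close>

lemma fps_coeffs_of_ode:
  fixes F P :: "complex fps"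
  assumes F1: "fps_nth F 1 = 1"
    and ode: "fps_deriv (fps_deriv F) * (1 - fps_X * P) = 3 * P * fps_deriv F"
  defines "p \<equiv> fps_nth P"
  shows "fps_nth F 2 = 3/2 * p 0"
    and "fps_nth F 3 = 2 * p 0^2 + 1/2 * p 1"
    and "fps_nth F 4 = 5/2 * p 0^3 + 13/8 * p 0 * p 1 + 1/4 * p 2"
    and "fps_nth F 5 = 3 * p 0^4 + 69/20 * p 0^2 * p 1 + 3/8 * p 1^2 + 9/10 * p 0 * p 2 + 3/20 * p 3"
proof -
  define d e where "d = fps_nth (fps_deriv F)" and "e = fps_nth (fps_deriv (fps_deriv F))"
  have d: "d 0 = 1" "d 1 = 2 * fps_nth F 2" "d 2 = 3 * fps_nth F 3" "d 3 = 4 * fps_nth F 4"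
    using F1 by (simp_all add: d_def eval_nat_numeral)
  have e: "e 0 = 2 * fps_nth F 2" "e 1 = 6 * fps_nth F 3" "e 2 = 12 * fps_nth F 4"
    "e 3 = 20 * fps_nth F 5"
    by (simp_all add: e_def eval_nat_numeral)
  have eq: "fps_deriv (fps_deriv F) = fps_X * (P * fps_deriv (fps_deriv F))
              + fps_const 3 * (P * fps_deriv F)"
    using ode by (simp add: algebra_simps numeral_fps_const)
  have 0: "e 0 = 3 * (p 0 * d 0)"
    unfolding e_def by (subst eq) (simp add: p_def d_def)
  have Suc: "e (Suc n) = (\<Sum>i\<le>n. p i * e (n - i)) + 3 * (\<Sum>i\<le>Suc n. p i * d (Suc n - i))" for n
  proof -
    have "fps_nth (fps_deriv (fps_deriv F)) (Suc n) =
        fps_nth (P * fps_deriv (fps_deriv F)) n + 3 * fps_nth (P * fps_deriv F) (Suc n)"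
      by (subst eq) (simp del: fps_deriv_nth)
    then show ?thesis
      by (simp only: e_def d_def p_def fps_mult_nth atMost_atLeast0)
  qed
  have 1: "e 1 = p 0 * e 0 + 3 * (p 0 * d 1 + p 1 * d 0)"
    using Suc[of 0] by simp
  have 2: "e 2 = p 0 * e 1 + p 1 * e 0 + 3 * (p 0 * d 2 + p 1 * d 1 + p 2 * d 0)"
    using Suc[of 1] by (simp add: numeral_2_eq_2)
  have 3: "e 3 = p 0 * e 2 + p 1 * e 1 + p 2 * e 0
              + 3 * (p 0 * d 3 + p 1 * d 2 + p 2 * d 1 + p 3 * d 0)"
    using Suc[of 2] by (simp add: eval_nat_numeral)
  show F2: "fps_nth F 2 = 3/2 * p 0"
    using 0 unfolding d e by (simp add: field_simps)
  have "6 * fps_nth F 3 = 6 * (2 * p 0^2 + 1/2 * p 1)"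
    using 1 unfolding d e F2 by (simp add: algebra_simps power2_eq_square)
  then show F3: "fps_nth F 3 = 2 * p 0^2 + 1/2 * p 1"
    by (simp only: mult_cancel_left) simp
  have "12 * fps_nth F 4 = 12 * (5/2 * p 0^3 + 13/8 * p 0 * p 1 + 1/4 * p 2)"
    using 2 unfolding d e F2 F3 by (simp add: algebra_simps power2_eq_square power3_eq_cube)
  then show F4: "fps_nth F 4 = 5/2 * p 0^3 + 13/8 * p 0 * p 1 + 1/4 * p 2"
    by (simp only: mult_cancel_left) simp
  have "20 * fps_nth F 5 = 20 * (3 * p 0^4 + 69/20 * p 0^2 * p 1 + 3/8 * p 1^2
                                 + 9/10 * p 0 * p 2 + 3/20 * p 3)"
    using 3 unfolding d e F2 F3 F4 by (simp add: algebra_simps eval_nat_numeral)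
  then show "fps_nth F 5 = 3 * p 0^4 + 69/20 * p 0^2 * p 1 + 3/8 * p 1^2
                           + 9/10 * p 0 * p 2 + 3/20 * p 3"
    by (simp only: mult_cancel_left) simp
qed

text \<open>Reversion of a power series up to the fifth coefficient.\<close>

lemma fps_coeffs_of_inverse:
  fixes F G :: "complex fps"
  assumes F0: "fps_nth F 0 = 0" and F1: "fps_nth F 1 = 1" and G0: "fps_nth G 0 = 0"
    and inv: "fps_compose F G = fps_X"
  defines "a \<equiv> fps_nth F"
  shows "fps_nth G 1 = 1"
    and "fps_nth G 2 = - a 2"
    and "fps_nth G 3 = 2 * a 2^2 - a 3"
    and "fps_nth G 4 = 5 * a 2 * a 3 - 5 * a 2^3 - a 4"
    and "fps_nth G 5 = 14 * a 2^4 - 21 * a 2^2 * a 3 + 6 * a 2 * a 4 + 3 * a 3^2 - a 5"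
proof -
  define t where "t = fps_nth G"
  have comp: "fps_nth fps_X n = (\<Sum>i=0..n. a i * fps_nth (G ^ i) n)" for n
    unfolding inv[symmetric] a_def by (rule fps_compose_nth)
  have a: "a 0 = 0" "a (Suc 0) = 1"
    using F0 F1 by (simp_all add: a_def)
  have t1: "t (Suc 0) = 1"
    using comp[of 1] by (simp add: a t_def)
  have t0: "t 0 = 0"
    by (simp add: t_def G0)
  have G: "fps_nth G = t"
    by (simp add: t_def)
  have S: "{0..1::nat} = {0,1}" "{0..2::nat} = {0,1,2}" "{0..3::nat} = {0,1,2,3}"
    "{0..4::nat} = {0,1,2,3,4}" "{0..5::nat} = {0,1,2,3,4,5}"
    by auto
  have G2_eq: "G^2 = G * G" and G3_eq: "G^3 = G * G^2" and G4_eq: "G^4 = G * G^3" and G5_eq: "G^5 = G * G^4"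
    by (simp_all add: eval_nat_numeral)
  have G2: "fps_nth (G^2) 0 = 0" "fps_nth (G^2) 1 = 0" "fps_nth (G^2) 2 = 1" "fps_nth (G^2) 3 = 2 * t 2"
    "fps_nth (G^2) 4 = 2 * t 3 + t 2^2" "fps_nth (G^2) 5 = 2 * t 4 + 2 * t 2 * t 3"
    unfolding G2_eq fps_mult_nth S by (simp_all add: G t0 t1 power2_eq_square[of "t 2"])
  have G3: "fps_nth (G^3) 0 = 0" "fps_nth (G^3) 1 = 0" "fps_nth (G^3) 2 = 0" "fps_nth (G^3) 3 = 1"
    "fps_nth (G^3) 4 = 3 * t 2" "fps_nth (G^3) 5 = 3 * t 3 + 3 * t 2^2"
    unfolding G3_eq fps_mult_nth S by (simp_all add: G G2 G2(2)[simplified] t0 t1 power2_eq_square[of "t 2"])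
  have G4: "fps_nth (G^4) 0 = 0" "fps_nth (G^4) 1 = 0" "fps_nth (G^4) 2 = 0" "fps_nth (G^4) 3 = 0"
    "fps_nth (G^4) 4 = 1" "fps_nth (G^4) 5 = 4 * t 2"
    unfolding G4_eq fps_mult_nth S by (simp_all add: G G3 G3(2)[simplified] t0 t1)
  have G5: "fps_nth (G^5) 5 = 1"
    unfolding G5_eq fps_mult_nth S by (simp add: G G4 G4(2)[simplified] t0 t1)
  have 2: "0 = t 2 + a 2"
    using comp[of 2] by (simp add: S a G2 G)
  have 3: "0 = t 3 + a 2 * (2 * t 2) + a 3"
    using comp[of 3] by (simp add: S a G2 G3 G add.assoc)
  have 4: "0 = t 4 + a 2 * (2 * t 3 + t 2^2) + a 3 * (3 * t 2) + a 4"
    using comp[of 4] by (simp add: S a G2 G3 G4 G add.assoc)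
  have 5: "0 = t 5 + a 2 * (2 * t 4 + 2 * t 2 * t 3) + a 3 * (3 * t 3 + 3 * t 2^2) + a 4 * (4 * t 2) + a 5"
    using comp[of 5] by (simp add: S a G2 G3 G4 G5 G add.assoc)
  show "fps_nth G 1 = 1"
    using t1 by (simp add: G)
  have t2: "t 2 = - a 2"
    using 2 by algebra
  have t3: "t 3 = 2 * a 2^2 - a 3"
    using 3 unfolding t2 by algebra
  have t4: "t 4 = 5 * a 2 * a 3 - 5 * a 2^3 - a 4"
    using 4 unfolding t2 t3 by algebra
  have t5: "t 5 = 14 * a 2^4 - 21 * a 2^2 * a 3 + 6 * a 2 * a 4 + 3 * a 3^2 - a 5"
    using 5 unfolding t2 t3 t4 by algebra
  show "fps_nth G 2 = - a 2"
    and "fps_nth G 3 = 2 * a 2^2 - a 3"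
    and "fps_nth G 4 = 5 * a 2 * a 3 - 5 * a 2^3 - a 4"
    and "fps_nth G 5 = 14 * a 2^4 - 21 * a 2^2 * a 3 + 6 * a 2 * a 4 + 3 * a 3^2 - a 5"
    using t2 t3 t4 t5 unfolding G .
qed

text \<open>The Taylor coefficient of \<open>\<phi>\<close> of index \<open>i\<close> is the one of \<open>z \<phi>\<close> of index \<open>i + 1\<close>.\<close>

lemma hankel_inverse_eq:
  assumes f: "f \<in> class_A" and \<phi>: "\<phi> \<in> schur_class"
    and ode: "\<And>z. z \<in> unit_disc \<Longrightarrow> deriv (deriv f) z * (1 - z * \<phi> z) = 3 * \<phi> z * deriv f z"
    and g: "inverse_near_0 f g"
  shows "320 * hankel_3_1 (taylor_coeff g) =
    hankel_poly (taylor_coeff \<phi> 0) (taylor_coeff \<phi> 1) (taylor_coeff \<phi> 2) (taylor_coeff \<phi> 3)"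
proof -
  have f': "f holomorphic_on unit_disc" "f 0 = 0" "deriv f 0 = 1"
    using f by (auto simp: class_A_iff)
  obtain r where g0: "g 0 = 0" and r: "r > 0" "g holomorphic_on ball 0 r"
    "\<And>w. w \<in> ball 0 r \<Longrightarrow> f (g w) = w"
    using g by (auto simp: inverse_near_0_def)
  define F G P where "F = fps_expansion f 0" and "G = fps_expansion g 0" and "P = fps_expansion \<phi> 0"
  have F: "f has_fps_expansion F"
    unfolding F_def using f'(1) by (intro has_fps_expansion_fps_expansion[of "unit_disc"]) auto
  have G: "g has_fps_expansion G"
    unfolding G_def using r by (intro has_fps_expansion_fps_expansion[of "ball 0 r"]) auto
  have P: "\<phi> has_fps_expansion P"
    unfolding P_def using \<phi> by (rule schur_class_has_fps_expansion)
  have F01: "fps_nth F 0 = 0" "fps_nth F 1 = 1" and G0: "fps_nth G 0 = 0"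
    using f' g0 by (simp_all add: F_def G_def fps_expansion_def)
  have 1: "fps_deriv (fps_deriv F) * (1 - fps_X * P) = 3 * P * fps_deriv F"
  proof (rule has_fps_expansion_eqI)
    show "(\<lambda>z. deriv (deriv f) z * (1 - z * \<phi> z)) has_fps_expansion
            fps_deriv (fps_deriv F) * (1 - fps_X * P)"
      by (intro fps_expansion_intros F P)
    show "(\<lambda>z. 3 * \<phi> z * deriv f z) has_fps_expansion 3 * P * fps_deriv F"
      by (intro fps_expansion_intros F P)
  qed (use ode in \<open>auto intro: open_ball[of 0 1]\<close>)
  have 2: "fps_compose F G = fps_X"
  proof (rule has_fps_expansion_eqI)
    show "(f \<circ> g) has_fps_expansion fps_compose F G"
      by (intro has_fps_expansion_compose F G G0)
    show "(\<lambda>z. z) has_fps_expansion fps_X"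
      by (intro fps_expansion_intros)
  qed (use r in \<open>auto intro: open_ball[of 0 r]\<close>)
  note a = fps_coeffs_of_ode[OF F01(2) 1]
  note t = fps_coeffs_of_inverse[OF F01 G0 2]
  define p where "p = fps_nth P"
  have t2: "taylor_coeff g 2 = - 3/2 * p 0"
    and t3: "taylor_coeff g 3 = 5/2 * p 0^2 - 1/2 * p 1"
    and t4: "taylor_coeff g 4 = - 35/8 * p 0^3 + 17/8 * p 0 * p 1 - 1/4 * p 2"
    and t5: "taylor_coeff g 5 = 63/8 * p 0^4 - 129/20 * p 0^2 * p 1 + 27/20 * p 0 * p 2
               + 3/8 * p 1^2 - 3/20 * p 3"
    unfolding taylor_coeff_def G_def[symmetric] t a p_def[symmetric]
    by (simp_all add: field_simps eval_nat_numeral)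
  have t1: "taylor_coeff g 1 = 1"
    unfolding taylor_coeff_def G_def[symmetric] using t(1) by simp
  have "320 * hankel_3_1 (taylor_coeff g) = hankel_poly (p 0) (p 1) (p 2) (p 3)"
    unfolding hankel_3_1_expand[where t = "taylor_coeff g", OF t1] t2 t3 t4 t5 hankel_poly_def
    by (simp add: field_simps eval_nat_numeral)
  then show ?thesis
    by (simp add: p_def P_def taylor_coeff_def)
qed

section \<open>The bound\<close>

lemma ozaki_imp_schur:
  assumes "f \<in> ozaki_close_to_convex"
  obtains \<phi> where "\<phi> \<in> schur_class"
    "\<And>z. z \<in> unit_disc \<Longrightarrow> deriv (deriv f) z * (1 - z * \<phi> z) = 3 * \<phi> z * deriv f z"
proof -
  define q where "q = (\<lambda>z. deriv (deriv f) z / deriv f z)"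
  have hol: "f holomorphic_on unit_disc"
    and nz: "\<And>z. norm z < 1 \<Longrightarrow> deriv f z \<noteq> 0"
    and re: "\<And>z. norm z < 1 \<Longrightarrow> Re (z * q z) > - 3 / 2"
    using assms by (force simp: ozaki_close_to_convex_def class_A_iff q_def)+
  have nz3: "3 + z * q z \<noteq> 0" if "norm z < 1" for z
  proof
    assume "3 + z * q z = 0"
    then have "z * q z = - 3"
      by (simp add: add_eq_0_iff)
    with re[OF that] show False
      by simp
  qed
  \<comment> \<open>\<open>u \<mapsto> u / (3 + u)\<close> maps the half-plane \<open>Re u > - 3 / 2\<close> to the unit disc.\<close>
  define \<phi> where "\<phi> = (\<lambda>z. q z / (3 + z * q z))"
  have hol_q: "q holomorphic_on unit_disc"
    unfolding q_def using nz by (intro holomorphic_intros holomorphic_deriv hol) auto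
  have hol_\<phi>: "\<phi> holomorphic_on unit_disc"
    unfolding \<phi>_def using nz3 by (intro holomorphic_intros hol_q) auto
  have lt: "norm (z * \<phi> z) < 1" if z: "norm z < 1" for z
  proof -
    define u where "u = z * q z"
    have "norm u ^ 2 < norm (3 + u) ^ 2"
      using re[OF z] unfolding cmod_power2 u_def[symmetric]
      by (simp add: power2_eq_square algebra_simps)
    then have "norm u < norm (3 + u)"
      by (rule power_less_imp_less_base) simp
    then show ?thesis
      using nz3[OF z] by (simp add: \<phi>_def norm_divide u_def[symmetric])
  qed
  have "(\<lambda>z. z * \<phi> z) holomorphic_on unit_disc"
    by (intro holomorphic_intros hol_\<phi>)
  note schwarz = Schwarz_Lemma[OF this _ lt, simplified]
  have "norm (\<phi> z) \<le> 1" if z: "norm z < 1" for z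
  proof (cases "z = 0")
    case True
    have "((\<lambda>z. z * \<phi> z) has_field_derivative 1 * \<phi> 0 + deriv \<phi> 0 * 0) (at 0)"
      by (intro DERIV_mult DERIV_ident holomorphic_derivI[OF hol_\<phi>]) auto
    then have "deriv (\<lambda>z. z * \<phi> z) 0 = \<phi> 0"
      using DERIV_imp_deriv by fastforce
    then show ?thesis
      using schwarz(2)[of 0] True by simp
  next
    case False
    then show ?thesis
      using schwarz(1)[OF z] by (simp add: norm_mult)
  qed
  with hol_\<phi> have "\<phi> \<in> schur_class"
    by (simp add: schur_class_def)
  moreover have "deriv (deriv f) z * (1 - z * \<phi> z) = 3 * \<phi> z * deriv f z" if "z \<in> unit_disc" for z
  proof -
    have z: "norm z < 1"
      using that by simp
    have "1 - z * \<phi> z = 3 / (3 + z * q z)"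
      using nz3[OF z] by (simp add: \<phi>_def field_simps)
    moreover have "deriv (deriv f) z = q z * deriv f z"
      using nz[OF z] by (simp add: q_def)
    ultimately show ?thesis
      by (simp add: \<phi>_def)
  qed
  ultimately show ?thesis
    by (rule that)
qed

lemma norm_hankel_inverse_le:
  assumes f: "f \<in> ozaki_close_to_convex" and g: "inverse_near_0 f g"
  shows "norm (hankel_3_1 (taylor_coeff g)) \<le> 1 / 16"
proof -
  have A: "f \<in> class_A"
    using f by (simp add: ozaki_close_to_convex_def)
  obtain \<phi> where \<phi>: "\<phi> \<in> schur_class"
    "\<And>z. z \<in> unit_disc \<Longrightarrow> deriv (deriv f) z * (1 - z * \<phi> z) = 3 * \<phi> z * deriv f z"
    using ozaki_imp_schur[OF f] by blast
  obtain c x y w where le: "norm c \<le> 1" "norm x \<le> 1" "norm y \<le> 1" "norm w \<le> 1"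
    and coeffs: "taylor_coeff \<phi> 0 = c"
    "taylor_coeff \<phi> 1 = (1 - c * cnj c) * x"
    "taylor_coeff \<phi> 2 = (1 - c * cnj c) * ((1 - x * cnj x) * y - cnj c * x^2)"
    "taylor_coeff \<phi> 3 = (1 - c * cnj c) * ((cnj c)^2 * x^3
       - (1 - x * cnj x) * (2 * cnj c * x * y + cnj x * y^2)
       + (1 - x * cnj x) * (1 - y * cnj y) * w)"
    using schur_parameters[OF \<phi>(1)] by metis
  have "320 * hankel_3_1 (taylor_coeff g) =
    hankel_poly (taylor_coeff \<phi> 0) (taylor_coeff \<phi> 1) (taylor_coeff \<phi> 2) (taylor_coeff \<phi> 3)"
    using A \<phi> g by (rule hankel_inverse_eq)
  then have "norm (320 * hankel_3_1 (taylor_coeff g)) \<le> 20"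
    unfolding coeffs using norm_hankel_poly_schur_le[OF le] by (simp only:)
  then show ?thesis
    by (simp add: norm_mult)
qed

section \<open>The extremal function\<close>

lemma csqrt_one_minus_square:
  fixes z :: complex
  assumes "norm z < 1"
  shows "1 - z\<^sup>2 \<notin> \<real>\<^sub>\<le>\<^sub>0" "csqrt (1 - z\<^sup>2) \<noteq> 0"
    and "((\<lambda>z. csqrt (1 - z\<^sup>2)) has_field_derivative - z / csqrt (1 - z\<^sup>2)) (at z)"
proof -
  have "norm (z\<^sup>2) < 1"
    using assms by (simp add: norm_power power_less_one_iff)
  then have "0 < Re (1 - z\<^sup>2)"
    using complex_Re_le_cmod[of "z\<^sup>2"] by simp
  then show nr: "1 - z\<^sup>2 \<notin> \<real>\<^sub>\<le>\<^sub>0"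
    by (auto simp: complex_nonpos_Reals_iff)
  then show "csqrt (1 - z\<^sup>2) \<noteq> 0"
    by auto
  show "((\<lambda>z. csqrt (1 - z\<^sup>2)) has_field_derivative - z / csqrt (1 - z\<^sup>2)) (at z)"
    by (rule derivative_eq_intros refl nr | simp)+
qed

lemma has_field_derivative_f0:
  fixes z :: complex
  assumes "norm z < 1"
  shows "((\<lambda>z. z / csqrt (1 - z\<^sup>2)) has_field_derivative 1 / csqrt (1 - z\<^sup>2) ^ 3) (at z)"
    and "((\<lambda>z. 1 / csqrt (1 - z\<^sup>2) ^ 3) has_field_derivative 3 * z / csqrt (1 - z\<^sup>2) ^ 5) (at z)"
proof -
  define s where "s = csqrt (1 - z\<^sup>2)"
  have s: "s \<noteq> 0" "s\<^sup>2 = 1 - z\<^sup>2"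
    using csqrt_one_minus_square[OF assms] by (auto simp: s_def)
  have "((\<lambda>z. z / csqrt (1 - z\<^sup>2)) has_field_derivative (1 * s - z * (- z / s)) / (s * s)) (at z)"
    unfolding s_def using s(1)
    by (intro DERIV_divide DERIV_ident csqrt_one_minus_square(3) assms) (auto simp: s_def)
  also have "(1 * s - z * (- z / s)) / (s * s) = (s\<^sup>2 + z\<^sup>2) / s ^ 3"
    using s(1) by (simp add: field_simps eval_nat_numeral)
  finally show "((\<lambda>z. z / csqrt (1 - z\<^sup>2)) has_field_derivative 1 / csqrt (1 - z\<^sup>2) ^ 3) (at z)"
    unfolding s(2) by (simp add: s_def)
  have "((\<lambda>z. 1 / csqrt (1 - z\<^sup>2) ^ 3) has_field_derivative
     (0 * s ^ 3 - 1 * (of_nat 3 * (- z / s * s ^ (3 - Suc 0)))) / (s ^ 3 * s ^ 3)) (at z)"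
    unfolding s_def using s(1)
    by (intro DERIV_divide DERIV_const DERIV_power csqrt_one_minus_square(3) assms) (auto simp: s_def)
  also have "(0 * s ^ 3 - 1 * (of_nat 3 * (- z / s * s ^ (3 - Suc 0)))) / (s ^ 3 * s ^ 3) = 3 * z / s ^ 5"
    using s(1) by (simp add: field_simps eval_nat_numeral)
  finally show "((\<lambda>z. 1 / csqrt (1 - z\<^sup>2) ^ 3) has_field_derivative 3 * z / csqrt (1 - z\<^sup>2) ^ 5) (at z)"
    by (simp add: s_def)
qed

lemma f0_class_A: "(\<lambda>z. z / csqrt (1 - z\<^sup>2)) \<in> class_A"
proof -
  have "(\<lambda>z. z / csqrt (1 - z\<^sup>2)) holomorphic_on unit_disc"
    using csqrt_one_minus_square(1,2) by (intro holomorphic_intros) auto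
  moreover have "deriv (\<lambda>z. z / csqrt (1 - z\<^sup>2)) 0 = 1"
    using DERIV_imp_deriv[OF has_field_derivative_f0(1)[of 0]] by simp
  ultimately show ?thesis
    by (simp add: class_A_iff)
qed

lemma deriv_f0:
  fixes z :: complex
  assumes "norm z < 1"
  defines "f0 \<equiv> \<lambda>z. z / csqrt (1 - z\<^sup>2)"
  shows "deriv f0 z = 1 / csqrt (1 - z\<^sup>2) ^ 3"
    and "deriv (deriv f0) z = 3 * z / csqrt (1 - z\<^sup>2) ^ 5"
proof -
  have 1: "deriv f0 w = 1 / csqrt (1 - w\<^sup>2) ^ 3" if "norm w < 1" for w
    unfolding f0_def by (rule DERIV_imp_deriv[OF has_field_derivative_f0(1)[OF that]])
  then show "deriv f0 z = 1 / csqrt (1 - z\<^sup>2) ^ 3"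
    using assms(1) .
  have "(deriv f0 has_field_derivative 3 * z / csqrt (1 - z\<^sup>2) ^ 5) (at z)"
    by (rule has_field_derivative_transform_within_open[OF has_field_derivative_f0(2)[OF assms(1)] open_ball[of 0 1]])
       (use assms(1) 1 in auto)
  then show "deriv (deriv f0) z = 3 * z / csqrt (1 - z\<^sup>2) ^ 5"
    by (rule DERIV_imp_deriv)
qed

text \<open>The equation of \<open>hankel_inverse_eq\<close> holds for this function with \<open>\<phi> z = z\<close>.\<close>

lemma f0_ode:
  fixes z :: complex
  assumes "norm z < 1"
  defines "f0 \<equiv> \<lambda>z. z / csqrt (1 - z\<^sup>2)"
  shows "deriv (deriv f0) z * (1 - z * z) = 3 * z * deriv f0 z"
proof -
  define s where "s = csqrt (1 - z\<^sup>2)"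
  have s: "s \<noteq> 0" "1 - z * z = s\<^sup>2"
    using csqrt_one_minus_square(2)[OF assms(1)] by (simp_all add: s_def power2_eq_square[of z])
  show ?thesis
    unfolding f0_def deriv_f0[OF assms(1)] s_def[symmetric] s(2)
    using s(1) by (simp add: field_simps eval_nat_numeral)
qed

lemma f0_ozaki: "(\<lambda>z. z / csqrt (1 - z\<^sup>2)) \<in> ozaki_close_to_convex"
proof -
  define f0 :: "complex \<Rightarrow> complex" where "f0 = (\<lambda>z. z / csqrt (1 - z\<^sup>2))"
  have "deriv f0 z \<noteq> 0 \<and> Re (1 + z * deriv (deriv f0) z / deriv f0 z) > - 1 / 2"
    if z: "norm z < 1" for z
  proof
    show nz: "deriv f0 z \<noteq> 0"
      unfolding f0_def deriv_f0(1)[OF z] using csqrt_one_minus_square(2)[OF z] by simp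
    define u where "u = z\<^sup>2"
    have u: "norm u < 1"
      using z by (simp add: u_def norm_power power_less_one_iff)
    then have "1 - u \<noteq> 0"
      by auto
    have "deriv (deriv f0) z * (1 - u) = 3 * z * deriv f0 z"
      using f0_ode[OF z] by (simp add: f0_def u_def power2_eq_square)
    then have "z * (deriv (deriv f0) z * (1 - u)) = 3 * u * deriv f0 z"
      by (simp add: u_def power2_eq_square)
    then have "z * deriv (deriv f0) z / deriv f0 z = 3 * u / (1 - u)"
      using nz \<open>1 - u \<noteq> 0\<close> by (simp add: frac_eq_eq mult.assoc)
    also have "\<dots> = 3 * (1 / (1 - u)) - 3"
      using \<open>1 - u \<noteq> 0\<close> by (simp add: field_simps)
    finally have eq: "1 + z * deriv (deriv f0) z / deriv f0 z = 3 * (1 / (1 - u)) - 2"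
      by simp
    have "Re (1 / (1 - u)) > 1 / 2"
    proof -
      have "norm u ^ 2 < 1"
        using u by (simp add: power_less_one_iff)
      then have "norm (1 - u) ^ 2 < 2 * Re (1 - u)"
        unfolding cmod_power2 by (simp add: power2_eq_square algebra_simps)
      moreover have "norm (1 - u) ^ 2 > 0"
        using \<open>1 - u \<noteq> 0\<close> by simp
      ultimately show ?thesis
        by (simp add: Re_divide' field_simps)
    qed
    moreover have "Re (3 * v - 2) = 3 * Re v - 2" for v
      by simp
    ultimately show "Re (1 + z * deriv (deriv f0) z / deriv f0 z) > - 1 / 2"
      unfolding eq by (simp only:)
  qed
  then show ?thesis
    using f0_class_A unfolding ozaki_close_to_convex_def f0_def by simp
qed

lemma norm_hankel_inverse_f0:
  assumes "inverse_near_0 (\<lambda>z. z / csqrt (1 - z\<^sup>2)) g"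
  shows "norm (hankel_3_1 (taylor_coeff g)) = 1 / 16"
proof -
  have "(\<lambda>z. z) \<in> schur_class"
    by (auto simp: schur_class_def)
  from hankel_inverse_eq[OF f0_class_A this f0_ode assms]
  have "320 * hankel_3_1 (taylor_coeff g) = hankel_poly (taylor_coeff (\<lambda>z. z) 0)
     (taylor_coeff (\<lambda>z. z) 1) (taylor_coeff (\<lambda>z. z) 2) (taylor_coeff (\<lambda>z. z) 3)"
    by simp
  also have "fps_expansion (\<lambda>z. z) 0 = (fps_X :: complex fps)"
    by (intro fps_expansion_eqI fps_expansion_intros)
  then have "hankel_poly (taylor_coeff (\<lambda>z. z) 0) (taylor_coeff (\<lambda>z. z) 1)
      (taylor_coeff (\<lambda>z. z) 2) (taylor_coeff (\<lambda>z. z) 3) = - 20"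
    by (simp add: taylor_coeff_def hankel_poly_def)
  finally have "hankel_3_1 (taylor_coeff g) = - 1 / 16"
    by (simp add: field_simps)
  then show ?thesis
    by simp
qed

theorem theorem2p1:
  shows "(\<forall>f\<in>ozaki_close_to_convex.
            (\<exists>g. inverse_near_0 f g) \<and>
            (\<forall>g. inverse_near_0 f g \<longrightarrow> norm (hankel_3_1 (taylor_coeff g)) \<le> 1 / 16))
       \<and> (\<lambda>z. z / csqrt (1 - z\<^sup>2)) \<in> ozaki_close_to_convex
       \<and> (\<exists>g. inverse_near_0 (\<lambda>z. z / csqrt (1 - z\<^sup>2)) g
             \<and> norm (hankel_3_1 (taylor_coeff g)) = 1 / 16)"
proof (intro conjI ballI allI impI)
  fix f
  assume "f \<in> ozaki_close_to_convex"
  then show "\<exists>g. inverse_near_0 f g"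
    by (intro inverse_near_0_exists) (simp add: ozaki_close_to_convex_def)
next
  fix f g
  assume "f \<in> ozaki_close_to_convex" "inverse_near_0 f g"
  then show "norm (hankel_3_1 (taylor_coeff g)) \<le> 1 / 16"
    by (rule norm_hankel_inverse_le)
next
  show "(\<lambda>z. z / csqrt (1 - z\<^sup>2)) \<in> ozaki_close_to_convex"
    by (rule f0_ozaki)
next
  show "\<exists>g. inverse_near_0 (\<lambda>z. z / csqrt (1 - z\<^sup>2)) g
             \<and> norm (hankel_3_1 (taylor_coeff g)) = 1 / 16"
    using inverse_near_0_exists[OF f0_class_A] norm_hankel_inverse_f0 by blast
qed

end
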